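(* Let $n, d, N \geq 1$ be integers, let $\sigma > 0$, let $x_1, \dots, x_N \in \mathbb{R}^n$, and let $c_i^k \in \mathbb{R}$ for $1 \leq i \leq N$, $1 \leq k \leq d$. Let $f = [f^1 \ \dots \ f^d] : \mathbb{R}^n \to \mathbb{R}^d$ be the Gaussian RBF interpolator with components $$f^k(x) = \sum_{i=1}^N c_i^k \, \phi(\|x - x_i\|), \qquad \phi(r) = e^{-r^2/\sigma^2}, \qquad k = 1, \dots, d.$$ Let $L_\phi := \sqrt{2}\, e^{-\frac{1}{2}} \sigma^{-1}$ and let $C \in \mathbb{R}^{N \times d}$ be the matrix of RBF coefficients with entries $C_{ij} = c_i^j$. Then for all $u, v \in \mathbb{R}^n$, $$\|f(u) - f(v)\| \leq L \, \|u - v\|,$$ where $L := \sqrt{N}\, L_\phi \, \|C\|_F$.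
   Context: $\|\cdot\|$ denotes the Euclidean norm (on $\mathbb{R}^n$ and on $\mathbb{R}^d$), and $\|C\|_F = \big(\sum_{i,j} C_{ij}^2\big)^{1/2}$ denotes the Frobenius norm of a matrix. The points $x_i$ are the kernel centers (training samples), and the function $f$ is called an interpolator because it is used to extend the embedding $x_i \mapsto y_i := f(x_i) \in \mathbb{R}^d$ to all of $\mathbb{R}^n$. *)

theory Defs
  imports "HOL-Analysis.Analysis"
begin

definition gauss_rbf :: "real \<Rightarrow> real \<Rightarrow> real" where
  "gauss_rbf \<sigma> r = exp (- (r\<^sup>2 / \<sigma>\<^sup>2))"

text \<open>The index types are \<open>'n\<close> for the coordinates of the domain, \<open>'N\<close> for the kernel
  centers and \<open>'d\<close> for the components of the interpolator; \<open>c i k\<close> is the coefficient of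
  center \<open>i\<close> in component \<open>k\<close>.\<close>

definition rbf_interpolator ::
  "real \<Rightarrow> ('N::finite \<Rightarrow> real ^ 'n) \<Rightarrow> ('N \<Rightarrow> 'd \<Rightarrow> real) \<Rightarrow> real ^ 'n \<Rightarrow> real ^ 'd"
where
  "rbf_interpolator \<sigma> x c u = (\<chi> k. \<Sum>i\<in>UNIV. c i k * gauss_rbf \<sigma> (norm (u - x i)))"

definition rbf_coeff_matrix :: "('N \<Rightarrow> 'd \<Rightarrow> real) \<Rightarrow> real ^ 'd ^ 'N" where
  "rbf_coeff_matrix c = (\<chi> i j. c i j)"

definition frobenius_norm :: "real ^ 'd ^ 'N \<Rightarrow> real" where
  "frobenius_norm C = sqrt (\<Sum>i\<in>UNIV. \<Sum>j\<in>UNIV. (C $ i $ j)\<^sup>2)"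

definition gauss_lipschitz_const :: "real \<Rightarrow> real" where
  "gauss_lipschitz_const \<sigma> = sqrt 2 * exp (- 1 / 2) * inverse \<sigma>"

definition rbf_lipschitz_const :: "real \<Rightarrow> ('N::finite \<Rightarrow> 'd::finite \<Rightarrow> real) \<Rightarrow> real" where
  "rbf_lipschitz_const \<sigma> c =
     sqrt (real CARD('N)) * gauss_lipschitz_const \<sigma> * frobenius_norm (rbf_coeff_matrix c)"

end

theory Submission
  imports Defs
begin

text \<open>The profile \<open>\<phi>\<close> is \<open>L\<^sub>\<phi>\<close>-Lipschitz by the mean value theorem, since
  \<open>\<bar>\<phi>' r\<bar> = (2 / \<sigma>) t exp (- t\<^sup>2)\<close> with \<open>t = \<bar>r\<bar> / \<sigma>\<close>, and \<open>s \<le> exp (s - 1)\<close> at \<open>s = 2 t\<^sup>2\<close>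
  bounds this by \<open>L\<^sub>\<phi>\<close>. The Cauchy--Schwarz inequality over the centers, applied in each
  component, then gives the factor \<open>sqrt N \<parallel>C\<parallel>\<^sub>F\<close>.\<close>

text \<open>Both sides are nonnegative, so it suffices to compare squares. Squaring removes the
  absolute value and leaves \<open>s * exp (- s) \<le> exp (- 1)\<close> with
  \<open>s = 2 * t\<^sup>2\<close>.\<close>

lemma mult_exp_neg_square_le:
  fixes t :: real
  shows "sqrt 2 * \<bar>t\<bar> * exp (- t\<^sup>2) \<le> exp (- 1 / 2)"
proof (rule power2_le_imp_le)
  have "2 * t\<^sup>2 \<le> exp (2 * t\<^sup>2 - 1)"
    using exp_ge_add_one_self[of "2 * t\<^sup>2 - 1"] by simp
  then have "2 * t\<^sup>2 * exp (- (2 * t\<^sup>2)) \<le> exp (2 * t\<^sup>2 - 1) * exp (- (2 * t\<^sup>2))"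
    by (intro mult_right_mono) auto
  also have "\<dots> = exp (- 1)"
    by (simp flip: exp_add)
  finally show "(sqrt 2 * \<bar>t\<bar> * exp (- t\<^sup>2))\<^sup>2 \<le> (exp (- 1 / 2))\<^sup>2"
    by (simp add: power_mult_distrib flip: exp_double)
qed simp

lemma gauss_rbf_lipschitz:
  assumes "\<sigma> > 0"
  shows "\<bar>gauss_rbf \<sigma> r - gauss_rbf \<sigma> s\<bar> \<le> gauss_lipschitz_const \<sigma> * \<bar>r - s\<bar>"
proof -
  let ?D = "\<lambda>z. - (2 * z / \<sigma>\<^sup>2) * exp (- (z\<^sup>2 / \<sigma>\<^sup>2))"
  have "(gauss_rbf \<sigma> has_field_derivative ?D z) (at z within UNIV)" for z
    unfolding gauss_rbf_def[abs_def] using assms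
    by (auto intro!: derivative_eq_intros simp: field_simps eval_nat_numeral)
  moreover have "norm (?D z) \<le> gauss_lipschitz_const \<sigma>" for z
  proof -
    \<comment> \<open>The factor 2 is split as \<open>sqrt 2 * sqrt 2\<close>: one root completes
      the bounded expression in \<open>t = z / \<sigma>\<close>, the other remains in the Lipschitz
      constant.\<close>
    have "norm (?D z) = sqrt 2 * inverse \<sigma> * (sqrt 2 * \<bar>z / \<sigma>\<bar> * exp (- (z / \<sigma>)\<^sup>2))"
      using assms by (simp add: abs_mult power_divide divide_simps power2_eq_square)
    also have "\<dots> \<le> sqrt 2 * inverse \<sigma> * exp (- 1 / 2)"
      using assms by (intro mult_left_mono mult_exp_neg_square_le) auto
    finally show ?thesis
      by (simp add: gauss_lipschitz_const_def mult_ac)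
  qed
  ultimately show ?thesis
    using field_differentiable_bound[of UNIV "gauss_rbf \<sigma>" ?D "gauss_lipschitz_const \<sigma>" r s]
    by simp
qed

text \<open>The vector is the transpose of C applied to \<open>g\<close>. The Frobenius norm
  dominates the operator norm, and \<open>g\<close> has Euclidean norm at most
  \<open>sqrt N * B\<close>.\<close>

lemma norm_vec_sum_le_frobenius_norm:
  fixes c :: "'N::finite \<Rightarrow> 'd::finite \<Rightarrow> real" and g :: "'N \<Rightarrow> real"
  assumes "\<And>i. \<bar>g i\<bar> \<le> B"
  shows "norm (\<chi> k. \<Sum>i\<in>UNIV. c i k * g i)
           \<le> sqrt (real CARD('N)) * B * frobenius_norm (rbf_coeff_matrix c)"
proof -
  \<comment> \<open>Types are nonempty, so some index exists. The sign is needed at the end, where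
    \<open>sqrt (B\<^sup>2)\<close> becomes \<open>B\<close>.\<close>
  have B: "0 \<le> B"
    using assms[of undefined] by linarith
  have "(\<Sum>i\<in>UNIV. (g i)\<^sup>2) \<le> (\<Sum>i\<in>(UNIV :: 'N set). B\<^sup>2)"
    using assms by (intro sum_mono) (metis abs_ge_zero power2_abs power_mono)
  then have g: "(\<Sum>i\<in>UNIV. (g i)\<^sup>2) \<le> real CARD('N) * B\<^sup>2"
    by simp
  have "(\<Sum>i\<in>UNIV. c i k * g i)\<^sup>2 \<le> real CARD('N) * B\<^sup>2 * (\<Sum>i\<in>UNIV. (c i k)\<^sup>2)" for k
  proof -
    have "(\<Sum>i\<in>UNIV. c i k * g i)\<^sup>2 = (\<Sum>i\<in>UNIV. g i * c i k)\<^sup>2"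
      by (simp only: mult.commute)
    also have "\<dots> \<le> (\<Sum>i\<in>UNIV. (g i)\<^sup>2) * (\<Sum>i\<in>UNIV. (c i k)\<^sup>2)"
      by (rule Cauchy_Schwarz_ineq_sum)
    also have "\<dots> \<le> real CARD('N) * B\<^sup>2 * (\<Sum>i\<in>UNIV. (c i k)\<^sup>2)"
      by (intro mult_right_mono g sum_nonneg) auto
    finally show ?thesis .
  qed
  then have "(\<Sum>k\<in>UNIV. (\<Sum>i\<in>UNIV. c i k * g i)\<^sup>2)
          \<le> (\<Sum>k\<in>UNIV. real CARD('N) * B\<^sup>2 * (\<Sum>i\<in>UNIV. (c i k)\<^sup>2))"
    by (rule sum_mono)
  also have "\<dots> = real CARD('N) * B\<^sup>2 * (\<Sum>i\<in>UNIV. \<Sum>k\<in>UNIV. (c i k)\<^sup>2)"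
    \<comment> \<open>Fixing the index types orients the exchange, so the rewriting cannot
      loop.\<close>
    unfolding sum.swap[where A = "UNIV :: 'N set" and B = "UNIV :: 'd set"]
    by (rule sum_distrib_left[symmetric])
  finally have "sqrt (\<Sum>k\<in>UNIV. (\<Sum>i\<in>UNIV. c i k * g i)\<^sup>2)
      \<le> sqrt (real CARD('N) * B\<^sup>2 * (\<Sum>i\<in>UNIV. \<Sum>k\<in>UNIV. (c i k)\<^sup>2))"
    by (rule real_sqrt_le_mono)
  then show ?thesis
    using B by (simp add: norm_vec_def L2_set_def frobenius_norm_def rbf_coeff_matrix_def
        real_sqrt_mult)
qed

theorem proposition1:
  fixes \<sigma> :: real
    and x :: "'N::finite \<Rightarrow> real ^ 'n::finite"
    and c :: "'N \<Rightarrow> 'd::finite \<Rightarrow> real"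
    and u v :: "real ^ 'n"
  assumes "\<sigma> > 0"
  shows "norm (rbf_interpolator \<sigma> x c u - rbf_interpolator \<sigma> x c v)
           \<le> rbf_lipschitz_const \<sigma> c * norm (u - v)"
proof -
  define g where "g i = gauss_rbf \<sigma> (norm (u - x i)) - gauss_rbf \<sigma> (norm (v - x i))" for i
  have "\<bar>g i\<bar> \<le> gauss_lipschitz_const \<sigma> * norm (u - v)" for i
  proof -
    have "\<bar>g i\<bar> \<le> gauss_lipschitz_const \<sigma> * \<bar>norm (u - x i) - norm (v - x i)\<bar>"
      unfolding g_def by (rule gauss_rbf_lipschitz[OF assms])
    \<comment> \<open>By the reverse triangle inequality the center cancels, so the bound is uniform
      in \<open>i\<close>.\<close>
    also have "\<dots> \<le> gauss_lipschitz_const \<sigma> * norm (u - v)"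
      using assms norm_triangle_ineq3[of "u - x i" "v - x i"]
      by (intro mult_left_mono) (auto simp: gauss_lipschitz_const_def)
    finally show ?thesis .
  qed
  then have "norm (\<chi> k. \<Sum>i\<in>UNIV. c i k * g i) \<le> rbf_lipschitz_const \<sigma> c * norm (u - v)"
    using norm_vec_sum_le_frobenius_norm[of g "gauss_lipschitz_const \<sigma> * norm (u - v)" c]
    by (simp add: rbf_lipschitz_const_def mult_ac)
  moreover have "rbf_interpolator \<sigma> x c u - rbf_interpolator \<sigma> x c v
      = (\<chi> k. \<Sum>i\<in>UNIV. c i k * g i)"
    by (simp add: vec_eq_iff rbf_interpolator_def g_def right_diff_distrib sum_subtractf)
  ultimately show ?thesis
    by simp
qed

end
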